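(* If an $A$-orbit collides, it does so in finite time. That is, let $c:I\to T^*\mathcal H$ be an $A$-orbit with maximal interval $I=(t_-,t_+)$, $-\infty\le t_-<t_+\le\infty$, and configuration curve $\gamma(t)=(x(t),y(t),z(t))$. If $\gamma(t)\to(0,0,0)$ as $t\to t_+$, then $t_+<\infty$; and if $\gamma(t)\to(0,0,0)$ as $t\to t_-$, then $t_->-\infty$.
   Context: Configuration space $\mathcal H$ is $\mathbb R^3$ with coordinates $(x,y,z)$ (the Heisenberg group), with the origin (the location of the sun) excluded; a collision is convergence of the configuration to the origin, in future or past time. Phase space $T^*\mathcal H$ has canonical coordinates $(x,y,z,p_x,p_y,p_z)$. The Kepler-Heisenberg Hamiltonian is $$H=\tfrac12\big((p_x-\tfrac12 yp_z)^2+(p_y+\tfrac12 xp_z)^2\big)-\frac{1}{8\pi\sqrt{(x^2+y^2)^2+16z^2}}.$$ An $A$-orbit is a solution $c:I\to T^*\mathcal H$ of Hamilton's equations for $H$ on a maximal interval $I$ such that $H=0$ along $c$, the configuration curve does not meet the $z$-axis, and $z(t)$ has at least three discrete (isolated) zeros. *)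

theory Defs
  imports "HOL-Analysis.Analysis"
begin

text \<open>A phase point is a pair \<open>(q, p)\<close> with \<open>q = (x, y, z)\<close> and \<open>p = (p_x, p_y, p_z)\<close>.\<close>
type_synonym phase = "(real ^ 3) \<times> (real ^ 3)"

text \<open>At \<open>q = 0\<close> the potential takes the junk value \<open>0\<close>; the origin is excluded from
  configuration space in \<open>hamilton_solution\<close> below.\<close>
definition KH_hamiltonian :: "phase \<Rightarrow> real" where
  "KH_hamiltonian w = (let x = fst w $ 1; y = fst w $ 2; z = fst w $ 3;
                           px = snd w $ 1; py = snd w $ 2; pz = snd w $ 3 in
     1/2 * ((px - 1/2 * y * pz)\<^sup>2 + (py + 1/2 * x * pz)\<^sup>2)
     - 1 / (8 * pi * sqrt ((x\<^sup>2 + y\<^sup>2)\<^sup>2 + 16 * z\<^sup>2)))"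

text \<open>Hamilton's equations are \<open>q\<^sub>i' = \<partial>H/\<partial>p\<^sub>i\<close> and \<open>p\<^sub>i' = - \<partial>H/\<partial>q\<^sub>i\<close>; the partial
  derivatives are the Frechet derivative applied to the coordinate vectors.\<close>
definition hamiltonian_field :: "(phase \<Rightarrow> real) \<Rightarrow> phase \<Rightarrow> phase" where
  "hamiltonian_field H w =
     (\<chi> i. frechet_derivative H (at w) (0, axis i 1),
      \<chi> i. - frechet_derivative H (at w) (axis i 1, 0))"

text \<open>Time intervals are \<open>(a, b)\<close> with endpoints in the extended reals. A curve is a total
  function, but only its values on \<open>einterval a b\<close> matter.\<close>
definition hamilton_solution :: "ereal \<Rightarrow> ereal \<Rightarrow> (real \<Rightarrow> phase) \<Rightarrow> bool" where
  "hamilton_solution a b c \<longleftrightarrow> a < b \<and>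
     (\<forall>t\<in>einterval a b. fst (c t) \<noteq> 0 \<and>
        (c has_vector_derivative hamiltonian_field KH_hamiltonian (c t)) (at t))"

definition maximal_hamilton_solution :: "ereal \<Rightarrow> ereal \<Rightarrow> (real \<Rightarrow> phase) \<Rightarrow> bool" where
  "maximal_hamilton_solution a b c \<longleftrightarrow> hamilton_solution a b c \<and>
     (\<forall>a' b' c'. a' \<le> a \<and> b \<le> b' \<and> hamilton_solution a' b' c' \<and>
        (\<forall>t\<in>einterval a b. c' t = c t) \<longrightarrow> a' = a \<and> b' = b)"

definition A_orbit :: "ereal \<Rightarrow> ereal \<Rightarrow> (real \<Rightarrow> phase) \<Rightarrow> bool" where
  "A_orbit a b c \<longleftrightarrow> maximal_hamilton_solution a b c \<and>
     (\<forall>t\<in>einterval a b. KH_hamiltonian (c t) = 0) \<and>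
     (\<forall>t\<in>einterval a b. \<not> (fst (c t) $ 1 = 0 \<and> fst (c t) $ 2 = 0)) \<and>
     (\<exists>Z. card Z = 3 \<and> (\<forall>t\<in>Z. t isolated_in {s \<in> einterval a b. fst (c s) $ 3 = 0}))"

end

theory Submission imports Defs begin

text \<open>An orbit with enough crossings of the plane \<open>z = 0\<close> is self-similar, and a self-similar orbit can
  collide only at the limit of a geometric series of times.

  The system is invariant under rotations about the \<open>z\<close>-axis and under the dilations
  \<open>(x, y, z) \<mapsto> (\<lambda> x, \<lambda> y, \<lambda>\<^sup>2 z)\<close>, which multiply time by \<open>\<lambda>\<^sup>2\<close>. The angular momentum \<open>L\<close> is always
  conserved; the momentum \<open>J\<close> of the dilations has derivative \<open>2 H\<close>, so it is conserved at zero energy.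
  At a crossing of the plane \<open>z = 0\<close> the equation \<open>H = 0\<close> reads \<open>A\<^sup>2 + J\<^sup>2 = 1 / (4 \<pi>)\<close> with
  \<open>A = L + (x\<^sup>2 + y\<^sup>2) p\<^sub>z / 2\<close> (lemma \<open>zero_energy_plane\<close>). Along one orbit, \<open>A\<close> can therefore take only
  two values at such crossings, and two of any three crossings, say at times \<open>u < v\<close>, share it. The
  values of \<open>J\<close>, \<open>L\<close> and \<open>A\<close> determine a state over the punctured plane up to rotation and dilation
  (lemma \<open>similar_plane_states\<close>), so such a similarity carries \<open>c u\<close> to \<open>c v\<close>.

  Let \<open>m = \<lambda>\<^sup>2\<close> be its time factor. By uniqueness and maximality of the solution, the map
  \<open>\<phi> t = v + m (t - u)\<close> sends the interval of existence into itself and the similarity carries \<open>c t\<close> to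
  \<open>c (\<phi> t)\<close> (lemma \<open>maximal_solution_self_similar\<close>). The homogeneous quantity
  \<open>N = (x\<^sup>2 + y\<^sup>2)\<^sup>2 + 16 z\<^sup>2\<close> is positive off the origin and is multiplied by \<open>m\<^sup>2\<close> at each application
  of \<open>\<phi>\<close>. Suppose that the orbit exists for all times after \<open>u\<close>. If \<open>m < 1\<close>, then \<open>\<phi>\<close> has a fixed point
  after \<open>u\<close>, where \<open>N = m\<^sup>2 N\<close> is absurd. If \<open>m \<ge> 1\<close>, then the iterates of \<open>u\<close> under \<open>\<phi>\<close> tend to
  infinity while \<open>N\<close> stays at least \<open>N u\<close>, so there is no collision
  (lemma \<open>self_similar_not_tendsto_0_at_top\<close>). For the past, exchange \<open>u\<close> and \<open>v\<close> and reverse time.\<close>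

section \<open>Uniqueness for locally Lipschitz equations\<close>

definition lipschitz_near :: "('a::metric_space \<Rightarrow> 'b::metric_space) \<Rightarrow> 'a \<Rightarrow> bool" where
  "lipschitz_near f w \<longleftrightarrow> (\<exists>e>0. \<exists>K. K-lipschitz_on (ball w e) f)"

lemma lipschitz_nearI: "e > 0 \<Longrightarrow> K-lipschitz_on (ball w e) f \<Longrightarrow> lipschitz_near f w"
  by (auto simp: lipschitz_near_def)

lemma lipschitz_near_common:
  assumes "lipschitz_near f w" "lipschitz_near g w"
  obtains e K L where "e > 0" "K-lipschitz_on (ball w e) f" "L-lipschitz_on (ball w e) g"
proof -
  obtain d K e L where "d > 0" "K-lipschitz_on (ball w d) f" "e > 0" "L-lipschitz_on (ball w e) g"
    using assms by (auto simp: lipschitz_near_def)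
  then show ?thesis
    using that[of "min d e" K L] lipschitz_on_subset[of K "ball w d" f "ball w (min d e)"]
      lipschitz_on_subset[of L "ball w e" g "ball w (min d e)"]
    by (simp add: subset_ball)
qed

lemma lipschitz_near_bounded_linear:
  assumes "bounded_linear f" shows "lipschitz_near f w"
proof -
  obtain B where "B-lipschitz_on (ball w 1) f"
    using bounded_linear.lipschitz_boundE[OF assms] .
  then show ?thesis by (rule lipschitz_nearI[rotated]) simp
qed

lemma lipschitz_near_const: "lipschitz_near (\<lambda>w. a) w"
  by (rule lipschitz_nearI[of 1 0]) (simp_all add: lipschitz_on_constant)

lemma lipschitz_near_add:
  fixes f g :: "'a::metric_space \<Rightarrow> 'b::real_normed_vector"
  assumes "lipschitz_near f w" "lipschitz_near g w"
  shows "lipschitz_near (\<lambda>w. f w + g w) w"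
  by (rule lipschitz_near_common[OF assms]) (rule lipschitz_nearI[OF _ lipschitz_on_add])

lemma lipschitz_near_minus:
  fixes f :: "'a::metric_space \<Rightarrow> 'b::real_normed_vector"
  assumes "lipschitz_near f w"
  shows "lipschitz_near (\<lambda>w. - f w) w"
  using assms by (simp add: lipschitz_near_def)

lemma lipschitz_near_diff:
  fixes f g :: "'a::metric_space \<Rightarrow> 'b::real_normed_vector"
  assumes "lipschitz_near f w" "lipschitz_near g w"
  shows "lipschitz_near (\<lambda>w. f w - g w) w"
  by (rule lipschitz_near_common[OF assms]) (rule lipschitz_nearI[OF _ lipschitz_on_diff])

lemma lipschitz_near_Pair:
  assumes "lipschitz_near f w" "lipschitz_near g w"
  shows "lipschitz_near (\<lambda>w. (f w, g w)) w"
  by (rule lipschitz_near_common[OF assms]) (rule lipschitz_nearI[OF _ lipschitz_on_Pair])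

text \<open>Continuity of the inner function sends a small ball around \<open>w\<close> into the ball on which the outer
  one is Lipschitz.\<close>
lemma lipschitz_near_compose:
  assumes f: "lipschitz_near f w" and g: "lipschitz_near g (f w)"
  shows "lipschitz_near (\<lambda>w. g (f w)) w"
proof -
  obtain d K e L where d: "d > 0" "K-lipschitz_on (ball w d) f"
    and e: "e > 0" "L-lipschitz_on (ball (f w) e) g"
    using f g by (auto simp: lipschitz_near_def)
  have K: "K \<ge> 0" using d lipschitz_on_nonneg by blast
  define r where "r = min d (e / (K + 1))"
  have "dist (f u) (f w) < e" if "u \<in> ball w r" for u
  proof -
    have "dist (f u) (f w) \<le> K * dist u w"
      using that d by (intro lipschitz_onD[OF d(2)]) (auto simp: r_def)
    also have "\<dots> \<le> (K + 1) * dist u w" by (simp add: mult_right_mono)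
    also have "\<dots> < e" using that K by (auto simp: r_def field_simps dist_commute)
    finally show ?thesis .
  qed
  then have "f ` ball w r \<subseteq> ball (f w) e" by (auto simp: dist_commute)
  moreover have "ball w r \<subseteq> ball w d" by (auto simp: r_def)
  ultimately have "(L * K)-lipschitz_on (ball w r) (g \<circ> f)"
    using lipschitz_on_compose[OF lipschitz_on_subset[OF d(2)] lipschitz_on_subset[OF e(2)]] by blast
  moreover have "r > 0" using d e K by (simp add: r_def)
  ultimately show ?thesis by (intro lipschitz_nearI[of r]) (simp_all add: comp_def)
qed

lemma lipschitz_near_C1:
  fixes g :: "real \<Rightarrow> real"
  assumes S: "open S" "a \<in> S"
    and der: "\<And>x. x \<in> S \<Longrightarrow> (g has_real_derivative g' x) (at x)"
    and cont: "continuous_on S g'"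
  shows "lipschitz_near g a"
proof -
  obtain e where e: "e > 0" "cball a e \<subseteq> S" using S open_contains_cball by blast
  have "compact (g' ` cball a e)"
    using cont e by (intro compact_continuous_image) (auto intro: continuous_on_subset)
  then obtain B where B: "\<And>x. x \<in> cball a e \<Longrightarrow> \<bar>g' x\<bar> \<le> B"
    using compact_imp_bounded[of "g' ` cball a e"] unfolding bounded_iff real_norm_def by blast
  have "\<bar>g' a\<bar> \<le> B" using e(1) by (intro B) simp
  then have "B \<ge> 0" by linarith
  have "B-lipschitz_on (ball a e) g"
  proof (rule lipschitz_onI)
    fix x y assume xy: "x \<in> ball a e" "y \<in> ball a e"
    have "norm (g x - g y) \<le> B * norm (x - y)"
    proof (rule field_differentiable_bound)
      fix z assume z: "z \<in> ball a e"
      then have "z \<in> cball a e" by simp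
      then show "norm (g' z) \<le> B" using B[of z] by simp
      show "(g has_field_derivative g' z) (at z within ball a e)"
        using z e(2) by (intro has_field_derivative_at_within[OF der]) auto
    qed (use xy in auto)
    then show "dist (g x) (g y) \<le> B * dist x y" by (simp add: dist_norm)
  qed fact
  then show ?thesis using e by (intro lipschitz_nearI)
qed

text \<open>By the polarization identity \<open>2 f g = (f + g)\<^sup>2 - f\<^sup>2 - g\<^sup>2\<close>, products reduce to sums and to
  composition with the \<open>C\<^sup>1\<close> function \<open>x\<^sup>2\<close>, so no bounds on the factors have to be tracked.\<close>
lemma lipschitz_near_mult:
  fixes f g :: "'a::metric_space \<Rightarrow> real"
  assumes "lipschitz_near f w" "lipschitz_near g w"
  shows "lipschitz_near (\<lambda>w. f w * g w) w"
proof -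
  have sq: "lipschitz_near (\<lambda>w. (h w)\<^sup>2) w" if "lipschitz_near h w" for h :: "'a \<Rightarrow> real"
    using that by (rule lipschitz_near_compose, intro lipschitz_near_C1[of UNIV _ _ "\<lambda>x. 2 * x"])
      (auto intro!: derivative_eq_intros continuous_intros)
  have half: "lipschitz_near (\<lambda>r::real. r *\<^sub>R (1/2 :: real)) r" for r :: real
    by (intro lipschitz_near_bounded_linear bounded_linear_scaleR_left)
  have "lipschitz_near (\<lambda>w. ((f w + g w)\<^sup>2 - (f w)\<^sup>2 - (g w)\<^sup>2) *\<^sub>R (1/2 :: real)) w"
    by (intro lipschitz_near_compose[OF _ half] lipschitz_near_diff sq lipschitz_near_add assms)
  moreover have "((f w + g w)\<^sup>2 - (f w)\<^sup>2 - (g w)\<^sup>2) *\<^sub>R (1/2 :: real) = f w * g w" for w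
    by (simp add: power2_sum)
  ultimately show ?thesis by simp
qed

lemma lipschitz_near_vector_3:
  fixes f g h :: "'a::metric_space \<Rightarrow> real"
  assumes "lipschitz_near f w" "lipschitz_near g w" "lipschitz_near h w"
  shows "lipschitz_near (\<lambda>w. vector [f w, g w, h w] :: real ^ 3) w"
proof -
  have scale: "lipschitz_near (\<lambda>r::real. r *\<^sub>R v) r" for r and v :: "real ^ 3"
    by (intro lipschitz_near_bounded_linear bounded_linear_scaleR_left)
  have "lipschitz_near (\<lambda>w. f w *\<^sub>R axis 1 1 + g w *\<^sub>R axis 2 1 + h w *\<^sub>R axis 3 1 :: real ^ 3) w"
    by (intro lipschitz_near_add lipschitz_near_compose[OF _ scale] assms)
  moreover have "f w *\<^sub>R axis 1 1 + g w *\<^sub>R axis 2 1 + h w *\<^sub>R axis 3 1 = (vector [f w, g w, h w] :: real ^ 3)" for w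
    by (simp add: vec_eq_iff forall_3 axis_def)
  ultimately show ?thesis by simp
qed

text \<open>The times at which the two solutions agree form a relatively closed subset of the interval \<open>I\<close>.
  They also form an open one: near such a time the difference is bounded, by the mean value inequality,
  by half of its own maximum. Connectedness then gives agreement on all of \<open>I\<close>.\<close>
lemma ode_solution_unique:
  fixes F :: "'a::real_normed_vector \<Rightarrow> 'a" and c d :: "real \<Rightarrow> 'a"
  assumes lip: "\<And>w. w \<in> S \<Longrightarrow> \<exists>e>0. \<exists>K. K-lipschitz_on (ball w e) F"
    and I: "open I" "connected I"
    and c: "\<And>t. t \<in> I \<Longrightarrow> c t \<in> S \<and> (c has_vector_derivative F (c t)) (at t)"
    and d: "\<And>t. t \<in> I \<Longrightarrow> (d has_vector_derivative F (d t)) (at t)"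
    and t0: "t0 \<in> I" "c t0 = d t0" and t: "t \<in> I"
  shows "c t = d t"
proof -
  have cont: "continuous_on I c" "continuous_on I d"
    using c d by (meson continuous_at_imp_continuous_on has_vector_derivative_continuous)+
  define A where "A = {t \<in> I. c t = d t}"
  have "\<exists>r>0. ball u r \<subseteq> A" if u: "u \<in> A" for u
  proof -
    have uI: "u \<in> I" and eq: "c u = d u" using u by (auto simp: A_def)
    obtain e K where e: "e > 0" and K: "K-lipschitz_on (ball (c u) e) F"
      using lip c uI by blast
    have "isCont c u" "isCont d u"
      using c d uI has_vector_derivative_continuous by blast+
    then have "\<forall>\<^sub>F s in at u. dist (c s) (c u) < e" "\<forall>\<^sub>F s in at u. dist (d s) (d u) < e"
      using e by (auto simp: isCont_def tendsto_iff)
    moreover have "\<forall>\<^sub>F s in at u. s \<in> I" using I(1) uI eventually_at_topological by blast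
    ultimately have "\<forall>\<^sub>F s in at u. s \<in> I \<and> dist (c s) (c u) < e \<and> dist (d s) (c u) < e"
      by eventually_elim (use eq in simp)
    then obtain r where r: "r > 0"
      and near: "\<And>s. s \<noteq> u \<Longrightarrow> dist s u < r \<Longrightarrow> s \<in> I \<and> dist (c s) (c u) < e \<and> dist (d s) (c u) < e"
      by (auto simp: eventually_at)
    have near': "s \<in> I \<and> c s \<in> ball (c u) e \<and> d s \<in> ball (c u) e" if "dist s u < r" for s
      using near[of s] that uI e eq by (cases "s = u") (auto simp: dist_commute)
    have K0: "K \<ge> 0" using K lipschitz_on_nonneg by blast
    \<comment> \<open>With step \<open>q\<close> the Lipschitz constant \<open>K\<close> can amplify the difference by at most \<open>q K \<le> 1/2\<close>.\<close>
    define q where "q = min (r / 2) (1 / (2 * (K + 1)))"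
    have q: "q > 0" "q < r" "q * K \<le> 1/2"
    proof -
      show "q > 0" using r K0 by (simp add: q_def)
      show "q < r" using r by (simp add: q_def)
      have "q * K \<le> 1 / (2 * (K + 1)) * K" using K0 by (intro mult_right_mono) (simp_all add: q_def)
      also have "\<dots> \<le> 1/2" using K0 by (simp add: field_simps)
      finally show "q * K \<le> 1/2" .
    qed
    define J where "J = cball u q"
    have J: "J \<subseteq> I" using near' q by (auto simp: J_def dist_commute)
    obtain s where s: "s \<in> J" and max: "\<And>v. v \<in> J \<Longrightarrow> norm (c v - d v) \<le> norm (c s - d s)"
    proof -
      have "continuous_on J (\<lambda>v. norm (c v - d v))"
        using cont J by (intro continuous_intros) (auto intro: continuous_on_subset)
      moreover have "compact J" "J \<noteq> {}" using q by (auto simp: J_def)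
      ultimately show ?thesis
        using that continuous_attains_sup[of J "\<lambda>v. norm (c v - d v)"] by blast
    qed
    have "norm ((c s - d s) - (c u - d u)) \<le> (K * norm (c s - d s)) * norm (s - u)"
    proof (rule differentiable_bound[where S = J and f' = "\<lambda>v h. h *\<^sub>R (F (c v) - F (d v))"])
      show "convex J" by (simp add: J_def)
      show "((\<lambda>v. c v - d v) has_derivative (\<lambda>h. h *\<^sub>R (F (c v) - F (d v)))) (at v within J)"
        if "v \<in> J" for v
      proof -
        have "v \<in> I" using that J by blast
        then have "((\<lambda>v. c v - d v) has_vector_derivative F (c v) - F (d v)) (at v)"
          using c d by (intro has_vector_derivative_diff) auto
        then show ?thesis
          by (simp add: has_vector_derivative_def has_derivative_at_withinI)
      qed
      show "onorm (\<lambda>h. h *\<^sub>R (F (c v) - F (d v))) \<le> K * norm (c s - d s)" if v: "v \<in> J" for v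
      proof -
        have "norm (F (c v) - F (d v)) \<le> K * norm (c v - d v)"
          using near'[of v] v q by (intro lipschitz_on_normD[OF K]) (auto simp: J_def dist_commute)
        also have "\<dots> \<le> K * norm (c s - d s)" using max[OF v] K0 by (rule mult_left_mono)
        finally show ?thesis
          using onorm_scaleR_left[OF bounded_linear_ident, of "F (c v) - F (d v)"]
          by (simp add: onorm_id)
      qed
      show "s \<in> J" by fact
      show "u \<in> J" using q by (simp add: J_def)
    qed
    also have "\<dots> \<le> K * norm (c s - d s) * q"
      using s K0 by (intro mult_left_mono) (auto simp: J_def dist_norm norm_minus_commute)
    also have "\<dots> \<le> 1/2 * norm (c s - d s)"
      using mult_right_mono[OF q(3), of "norm (c s - d s)"] by (simp add: algebra_simps)
    finally have "norm (c s - d s) = 0" using eq by simp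
    then have "J \<subseteq> A" using max J by (force simp: A_def)
    then show ?thesis using q(1) by (force simp: J_def)
  qed
  then have "open A" by (simp add: open_contains_ball)
  then have "openin (top_of_set I) A"
    by (metis A_def inf.absorb_iff2 mem_Collect_eq openin_open subsetI)
  moreover have "closedin (top_of_set I) A"
  proof -
    have "closedin (top_of_set I) (I \<inter> (\<lambda>t. c t - d t) -` {0})"
      using cont by (intro continuous_closedin_preimage continuous_intros) auto
    moreover have "I \<inter> (\<lambda>t. c t - d t) -` {0} = A" by (auto simp: A_def)
    ultimately show ?thesis by simp
  qed
  moreover have "A \<noteq> {}" using t0 by (auto simp: A_def)
  ultimately have "A = I" using I(2) unfolding connected_clopen by blast
  then show ?thesis using t by (auto simp: A_def)
qed

section \<open>The Kepler-Heisenberg vector field\<close>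

text \<open>The fourth power of the Koranyi norm. It is homogeneous under the dilations of the Heisenberg
  group and measures the distance to the collision.\<close>
definition koranyi4 :: "phase \<Rightarrow> real" where
  "koranyi4 w = ((fst w $ 1)\<^sup>2 + (fst w $ 2)\<^sup>2)\<^sup>2 + 16 * (fst w $ 3)\<^sup>2"

lemma koranyi4_pos_iff: "koranyi4 w > 0 \<longleftrightarrow> fst w \<noteq> 0"
proof -
  have "koranyi4 w \<ge> 0" by (simp add: koranyi4_def)
  moreover have "koranyi4 w = 0 \<longleftrightarrow> fst w = 0"
    by (auto simp: koranyi4_def vec_eq_iff forall_3 add_nonneg_eq_0_iff)
  ultimately show ?thesis by linarith
qed

lemma koranyi4_tendsto_0:
  assumes "((\<lambda>t. fst (c t)) \<longlongrightarrow> 0) F"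
  shows "((\<lambda>t. koranyi4 (c t)) \<longlongrightarrow> 0) F"
proof -
  have q: "((\<lambda>t. fst (c t) $ i) \<longlongrightarrow> 0) F" for i using tendsto_vec_nth[OF assms, of i] by simp
  have "((\<lambda>t. koranyi4 (c t)) \<longlongrightarrow> (0\<^sup>2 + 0\<^sup>2)\<^sup>2 + 16 * 0\<^sup>2) F"
    unfolding koranyi4_def by (intro tendsto_add tendsto_power tendsto_mult tendsto_const q)
  then show ?thesis by simp
qed

text \<open>Hamilton's equations in coordinates. \<open>P\<close> and \<open>Q\<close> are the horizontal velocities \<open>x'\<close> and \<open>y'\<close>, and
  the terms with \<open>k\<close> are the force of the sun.\<close>
definition KH_field :: "phase \<Rightarrow> phase" where
  "KH_field w = (let x = fst w $ 1; y = fst w $ 2; z = fst w $ 3;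
                     px = snd w $ 1; py = snd w $ 2; pz = snd w $ 3;
                     P = px - 1/2 * y * pz; Q = py + 1/2 * x * pz;
                     k = inverse (4 * pi * sqrt (koranyi4 w) ^ 3) in
     (vector [P, Q, 1/2 * (x * Q - y * P)],
      vector [- (1/2 * Q * pz) - (x\<^sup>2 + y\<^sup>2) * x * k,
              1/2 * P * pz - (x\<^sup>2 + y\<^sup>2) * y * k,
              - (8 * z * k)]))"

lemma hamiltonian_field_KH:
  assumes "fst w \<noteq> 0"
  shows "hamiltonian_field KH_hamiltonian w = KH_field w"
proof -
  define x where "x = fst w $ 1"
  define y where "y = fst w $ 2"
  define z where "z = fst w $ 3"
  define px where "px = snd w $ 1"
  define py where "py = snd w $ 2"
  define pz where "pz = snd w $ 3"
  note dfs = x_def[symmetric] y_def[symmetric] z_def[symmetric] px_def[symmetric] py_def[symmetric] pz_def[symmetric]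
  define s where "s = sqrt ((x\<^sup>2 + y\<^sup>2)\<^sup>2 + 16 * z\<^sup>2)"
  have N: "(x\<^sup>2 + y\<^sup>2)\<^sup>2 + 16 * z\<^sup>2 > 0"
    using koranyi4_pos_iff[of w] assms by (simp add: koranyi4_def dfs)
  then have s: "s > 0" by (simp add: s_def)
  define P where "P = px - 1/2 * y * pz"
  define Q where "Q = py + 1/2 * x * pz"
  define k where "k = inverse (4 * pi * s ^ 3)"
  define D :: "phase \<Rightarrow> real" where "D h = P * (snd h $ 1 - 1/2 * (fst h $ 2 * pz + y * snd h $ 3))
     + Q * (snd h $ 2 + 1/2 * (fst h $ 1 * pz + x * snd h $ 3))
     + (4 * (x\<^sup>2 + y\<^sup>2) * (x * fst h $ 1 + y * fst h $ 2) + 32 * z * fst h $ 3) * (k / 4)" for h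
  have fc: "((\<lambda>w::phase. fst w $ i) has_derivative (\<lambda>h. fst h $ i)) (at w)" for i
    by (auto intro!: derivative_eq_intros bounded_linear.has_derivative[OF bounded_linear_vec_nth])
  have sc: "((\<lambda>w::phase. snd w $ i) has_derivative (\<lambda>h. snd h $ i)) (at w)" for i
    by (auto intro!: derivative_eq_intros bounded_linear.has_derivative[OF bounded_linear_vec_nth])
  have Nd: "((\<lambda>w::phase. ((fst w $ 1)\<^sup>2 + (fst w $ 2)\<^sup>2)\<^sup>2 + 16 * (fst w $ 3)\<^sup>2) has_derivative
      (\<lambda>h. 4 * (x\<^sup>2 + y\<^sup>2) * (x * fst h $ 1 + y * fst h $ 2) + 32 * z * fst h $ 3)) (at w)"
    by (rule derivative_eq_intros fc refl)+ (simp add: dfs fun_eq_iff algebra_simps power2_eq_square)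
  have Ud: "((\<lambda>w::phase. 1 / (8 * pi * sqrt (((fst w $ 1)\<^sup>2 + (fst w $ 2)\<^sup>2)\<^sup>2 + 16 * (fst w $ 3)\<^sup>2))) has_derivative
      (\<lambda>h. (4 * (x\<^sup>2 + y\<^sup>2) * (x * fst h $ 1 + y * fst h $ 2) + 32 * z * fst h $ 3) * (- (k / 4)))) (at w)"
  proof (rule DERIV_compose_FDERIV[OF _ Nd, where f="\<lambda>n. 1 / (8 * pi * sqrt n)", unfolded dfs])
    have "((\<lambda>n. 1 / (8 * pi * sqrt n)) has_real_derivative
            - (8 * pi * (inverse (sqrt n) / 2)) / (8 * pi * sqrt n)\<^sup>2) (at n)" if "n > 0" for n :: real
      using that by (auto intro!: derivative_eq_intros simp: power2_eq_square)
    from this[OF N] have "((\<lambda>n. 1 / (8 * pi * sqrt n)) has_real_derivative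
            - (8 * pi * (inverse s / 2)) / (8 * pi * s)\<^sup>2) (at ((x\<^sup>2 + y\<^sup>2)\<^sup>2 + 16 * z\<^sup>2))"
      unfolding s_def .
    moreover have "- (8 * pi * (inverse s / 2)) / (8 * pi * s)\<^sup>2 = - (k / 4)"
      using s by (simp add: k_def field_simps power2_eq_square power3_eq_cube)
    ultimately show "((\<lambda>n. 1 / (8 * pi * sqrt n)) has_real_derivative - (k / 4))
        (at ((x\<^sup>2 + y\<^sup>2)\<^sup>2 + 16 * z\<^sup>2))"
      by (simp only:)
  qed
  have "(KH_hamiltonian has_derivative D) (at w)"
    unfolding KH_hamiltonian_def Let_def
    by (rule has_derivative_eq_rhs[OF has_derivative_diff[OF _ Ud]],
        (rule derivative_eq_intros fc sc refl)+)
       (simp add: dfs P_def Q_def D_def fun_eq_iff add_divide_distrib diff_divide_distrib algebra_simps)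
  then have "frechet_derivative KH_hamiltonian (at w) = D"
    using frechet_derivative_at by metis
  moreover have "KH_field w = (vector [P, Q, 1/2 * (x * Q - y * P)],
      vector [- (1/2 * Q * pz) - (x\<^sup>2 + y\<^sup>2) * x * k,
              1/2 * P * pz - (x\<^sup>2 + y\<^sup>2) * y * k, - (8 * z * k)])"
    unfolding KH_field_def Let_def koranyi4_def dfs s_def[symmetric] P_def[symmetric] Q_def[symmetric] k_def[symmetric] ..
  ultimately show ?thesis
    by (simp add: hamiltonian_field_def prod_eq_iff vec_eq_iff forall_3 D_def axis_def algebra_simps)
qed

lemma KH_field_lipschitz_near:
  assumes "fst w \<noteq> 0"
  shows "lipschitz_near KH_field w"
proof -
  have lin: "lipschitz_near (\<lambda>w::phase. fst w $ i) w" "lipschitz_near (\<lambda>w::phase. snd w $ i) w" for i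
    by (intro lipschitz_near_bounded_linear bounded_linear_compose[OF bounded_linear_vec_nth]
        bounded_linear_fst bounded_linear_snd)+
  have inv: "lipschitz_near (\<lambda>n. inverse (4 * pi * sqrt n ^ 3)) n" if "n > 0" for n
    by (rule lipschitz_near_C1[where S="{0<..}" and g'="\<lambda>n. - (12 * pi * (sqrt n)\<^sup>2 * (inverse (sqrt n) / 2)) / (4 * pi * sqrt n ^ 3)\<^sup>2"])
       (use that in \<open>auto intro!: derivative_eq_intros continuous_intros simp: power2_eq_square field_simps\<close>)
  note intros = lipschitz_near_add lipschitz_near_diff lipschitz_near_mult lipschitz_near_minus
    lipschitz_near_const lin
  have "lipschitz_near koranyi4 w"
    unfolding koranyi4_def power2_eq_square by (intro intros)
  then have k: "lipschitz_near (\<lambda>w. inverse (4 * pi * sqrt (koranyi4 w) ^ 3)) w"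
    by (rule lipschitz_near_compose[OF _ inv]) (simp add: koranyi4_pos_iff assms)
  show ?thesis
    unfolding KH_field_def Let_def power2_eq_square
    by (intro lipschitz_near_Pair lipschitz_near_vector_3 intros k)
qed

lemma hamilton_solution_iff:
  "hamilton_solution a b c \<longleftrightarrow> a < b \<and>
     (\<forall>t\<in>einterval a b. fst (c t) \<noteq> 0 \<and> (c has_vector_derivative KH_field (c t)) (at t))"
  unfolding hamilton_solution_def by (auto simp: hamiltonian_field_KH)

section \<open>Maximal solutions\<close>

lemma is_interval_einterval: "is_interval (einterval a b)"
  unfolding is_interval_1 Ball_def einterval_iff
  by (meson ereal_less_eq(3) le_less_trans less_le_trans)

lemma hamilton_solution_unique:
  assumes c: "hamilton_solution a b c" and d: "hamilton_solution a b d"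
    and t0: "t0 \<in> einterval a b" "c t0 = d t0" and t: "t \<in> einterval a b"
  shows "c t = d t"
proof (rule ode_solution_unique[where S = "{w. fst w \<noteq> 0}" and F = KH_field])
  show "\<exists>e>0. \<exists>K. K-lipschitz_on (ball w e) KH_field" if "w \<in> {w. fst w \<noteq> 0}" for w
    using KH_field_lipschitz_near[of w] that by (simp add: lipschitz_near_def)
qed (use assms in \<open>auto simp: hamilton_solution_iff is_interval_einterval is_interval_connected\<close>)

lemma hamilton_solution_subinterval:
  assumes "hamilton_solution a b c" "a \<le> a'" "b' \<le> b" "a' < b'"
  shows "hamilton_solution a' b' c"
proof -
  have "einterval a' b' \<subseteq> einterval a b"
    using assms(2,3) by (auto simp: einterval_iff intro: le_less_trans less_le_trans)
  then show ?thesis using assms unfolding hamilton_solution_def by blast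
qed

text \<open>Two solutions that meet agree on the intersection of their intervals, so they glue to a solution on
  the union. Maximality forbids the union to be larger.\<close>
lemma maximal_hamilton_solution_absorbs:
  assumes max: "maximal_hamilton_solution a b c" and d: "hamilton_solution a' b' d"
    and t0: "t0 \<in> einterval a b" "t0 \<in> einterval a' b'" "c t0 = d t0"
    and t: "t \<in> einterval a' b'"
  shows "t \<in> einterval a b \<and> c t = d t"
proof -
  have c: "hamilton_solution a b c" using max by (simp add: maximal_hamilton_solution_def)
  have agree: "c s = d s" if "s \<in> einterval a b" "s \<in> einterval a' b'" for s
  proof (rule hamilton_solution_unique)
    have "max a a' < min b b'" using t0 by (auto simp: einterval_iff intro: less_trans)
    then show "hamilton_solution (max a a') (min b b') c" "hamilton_solution (max a a') (min b b') d"
      using c d by (auto intro: hamilton_solution_subinterval)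
  qed (use t0 that in \<open>auto simp: einterval_iff\<close>)
  define e where "e s = (if s \<in> einterval a b then c s else d s)" for s
  have e: "fst (e s) \<noteq> 0 \<and> (e has_vector_derivative KH_field (e s)) (at s)"
    if s: "s \<in> einterval (min a a') (max b b')" for s
  proof -
    \<comment> \<open>The two intervals share \<open>t0\<close>, so their union has no gap.\<close>
    have "s \<in> einterval a b \<or> s \<in> einterval a' b'"
      using s t0(1,2) unfolding einterval_iff
      by (smt (verit) less_trans linorder_less_linear max_def min_def less_le_trans le_less_trans)
    then obtain i j f where ij: "s \<in> einterval i j" and f: "hamilton_solution i j f"
      and ef: "\<And>r. r \<in> einterval i j \<Longrightarrow> e r = f r"
    proof
      assume "s \<in> einterval a b"
      then show thesis using c by (intro that[of a b c]) (auto simp: e_def)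
    next
      assume "s \<in> einterval a' b'"
      then show thesis using d agree by (intro that[of a' b' d]) (auto simp: e_def)
    qed
    have "(f has_vector_derivative KH_field (f s)) (at s)" "fst (f s) \<noteq> 0"
      using f ij by (auto simp: hamilton_solution_iff)
    moreover have "(e has_vector_derivative KH_field (f s)) (at s)"
      using calculation(1) open_einterval ij
      by (rule has_vector_derivative_transform_within_open) (simp add: ef)
    ultimately show ?thesis using ef[OF ij] by simp
  qed
  have "hamilton_solution (min a a') (max b b') e"
    using e c d by (auto simp: hamilton_solution_iff min_less_iff_disj less_max_iff_disj)
  moreover have "\<forall>s\<in>einterval a b. e s = c s" by (simp add: e_def)
  ultimately have "min a a' = a \<and> max b b' = b"
    using max unfolding maximal_hamilton_solution_def by (meson max.cobounded1 min.cobounded1)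
  then have "t \<in> einterval a b"
    using t unfolding einterval_iff by (metis max.cobounded2 min.cobounded2 le_less_trans less_le_trans)
  then show ?thesis using agree t by blast
qed

section \<open>Dilations and rotations\<close>

text \<open>The rotation and dilation that multiplies \<open>x + i y\<close> by the complex number \<open>a + i b\<close>, lifted to
  phase space as a canonical transformation. The dilation factor is the modulus of \<open>a + i b\<close>, so \<open>m\<close> is
  its square. Written this way, no angle is needed.\<close>
definition similarity :: "real \<Rightarrow> real \<Rightarrow> phase \<Rightarrow> phase" where
  "similarity a b w = (let x = fst w $ 1; y = fst w $ 2; z = fst w $ 3;
                           px = snd w $ 1; py = snd w $ 2; pz = snd w $ 3; m = a\<^sup>2 + b\<^sup>2 in
     (vector [a * x - b * y, b * x + a * y, m * z],
      vector [(a * px - b * py) / m, (b * px + a * py) / m, pz / m]))"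

lemma bounded_linear_similarity: "bounded_linear (similarity a b)"
proof -
  have "linear (similarity a b)"
    by (rule linearI)
       (simp_all add: similarity_def Let_def prod_eq_iff vec_eq_iff forall_3 algebra_simps add_divide_distrib diff_divide_distrib)
  then show ?thesis by (simp add: linear_conv_bounded_linear)
qed

lemma koranyi4_similarity: "koranyi4 (similarity a b w) = (a\<^sup>2 + b\<^sup>2)\<^sup>2 * koranyi4 w"
  by (simp add: koranyi4_def similarity_def Let_def power2_eq_square algebra_simps)

text \<open>The Hamiltonian is homogeneous of degree \<open>-2\<close> under dilations and invariant under rotations, so a
  similarity maps solutions to solutions with time multiplied by \<open>m = a\<^sup>2 + b\<^sup>2\<close>.\<close>
lemma KH_field_similarity:
  assumes m: "a\<^sup>2 + b\<^sup>2 > 0"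
  shows "KH_field (similarity a b w) = inverse (a\<^sup>2 + b\<^sup>2) *\<^sub>R similarity a b (KH_field w)"
proof -
  define x where "x = fst w $ 1"
  define y where "y = fst w $ 2"
  define z where "z = fst w $ 3"
  define px where "px = snd w $ 1"
  define py where "py = snd w $ 2"
  define pz where "pz = snd w $ 3"
  define m where "m = a\<^sup>2 + b\<^sup>2"
  define k where "k = inverse (4 * pi * sqrt (koranyi4 w) ^ 3)"
  define P where "P = px - 1/2 * y * pz"
  define Q where "Q = py + 1/2 * x * pz"
  define r where "r = x\<^sup>2 + y\<^sup>2"
  note dfs = x_def[symmetric] y_def[symmetric] z_def[symmetric] px_def[symmetric] py_def[symmetric]
    pz_def[symmetric] m_def[symmetric]
  have m0: "m > 0" using m by (simp add: m_def)
  have mm: "(a * x - b * y) * (b * P + a * Q) - (b * x + a * y) * (a * P - b * Q) = m * (x * Q - y * P)"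
    by (simp add: m_def power2_eq_square algebra_simps)
  \<comment> \<open>The velocities \<open>P\<close>, \<open>Q\<close> transform like the momenta \<open>px\<close>, \<open>py\<close>.\<close>
  have P': "(a * px - b * py) / m - 1/2 * (b * x + a * y) * (pz / m) = (a * P - b * Q) / m"
    by (simp add: P_def Q_def algebra_simps diff_divide_distrib add_divide_distrib)
  have Q': "(b * px + a * py) / m + 1/2 * (a * x - b * y) * (pz / m) = (b * P + a * Q) / m"
    by (simp add: P_def Q_def algebra_simps diff_divide_distrib add_divide_distrib)
  have r': "(a * x - b * y)\<^sup>2 + (b * x + a * y)\<^sup>2 = m * r"
    by (simp add: m_def r_def power2_eq_square algebra_simps)
  have "sqrt (koranyi4 (similarity a b w)) = m * sqrt (koranyi4 w)"
    using m0 by (simp add: koranyi4_similarity m_def[symmetric] real_sqrt_mult)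
  then have k': "inverse (4 * pi * sqrt (koranyi4 (similarity a b w)) ^ 3) = k / m ^ 3"
    by (simp add: k_def field_simps power_mult_distrib)
  have "KH_field (similarity a b w) = (vector [(a * P - b * Q) / m, (b * P + a * Q) / m,
          1/2 * ((a * x - b * y) * ((b * P + a * Q) / m) - (b * x + a * y) * ((a * P - b * Q) / m))],
      vector [- (1/2 * ((b * P + a * Q) / m) * (pz / m)) - (m * r) * (a * x - b * y) * (k / m ^ 3),
              1/2 * ((a * P - b * Q) / m) * (pz / m) - (m * r) * (b * x + a * y) * (k / m ^ 3),
              - (8 * (m * z) * (k / m ^ 3))])"
    unfolding KH_field_def Let_def k'
    by (simp only: similarity_def Let_def fst_conv snd_conv vector_3 dfs P' Q' r')
  moreover have "KH_field w = (vector [P, Q, 1/2 * (x * Q - y * P)],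
      vector [- (1/2 * Q * pz) - r * x * k, 1/2 * P * pz - r * y * k, - (8 * z * k)])"
    unfolding KH_field_def Let_def
    by (simp only: dfs P_def Q_def r_def k_def)
  moreover have "(a * x - b * y) * ((b * P + a * Q) / m) - (b * x + a * y) * ((a * P - b * Q) / m)
      = x * Q - y * P"
    using mm m0 by (simp only: times_divide_eq_right diff_divide_distrib[symmetric]) simp
  ultimately show ?thesis
    using m0 by (simp add: similarity_def Let_def prod_eq_iff vec_eq_iff forall_3 dfs)
      (simp add: field_simps power3_eq_cube)
qed

text \<open>Time is rescaled by \<open>t \<mapsto> v + m (t - u)\<close>; extended-real arithmetic on the endpoints covers bounded
  and unbounded intervals at once.\<close>
lemma mem_einterval_affine:
  fixes m u v :: real
  assumes "m > 0"
  shows "s \<in> einterval (ereal v + ereal m * (a - ereal u)) (ereal v + ereal m * (b - ereal u))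
           \<longleftrightarrow> u + (s - v) / m \<in> einterval a b"
proof -
  have "ereal v + ereal m * (a - ereal u) < ereal s \<longleftrightarrow> a < ereal (u + (s - v) / m)"
    using assms by (cases a) (auto simp: field_simps)
  moreover have "ereal s < ereal v + ereal m * (b - ereal u) \<longleftrightarrow> ereal (u + (s - v) / m) < b"
    using assms by (cases b) (auto simp: field_simps)
  ultimately show ?thesis by (simp add: einterval_iff)
qed

lemma hamilton_solution_similarity:
  fixes \<alpha> \<beta> u v :: real
  defines "m \<equiv> \<alpha>\<^sup>2 + \<beta>\<^sup>2"
  assumes c: "hamilton_solution a b c" and m: "m > 0"
  shows "hamilton_solution (ereal v + ereal m * (a - ereal u)) (ereal v + ereal m * (b - ereal u))
           (\<lambda>s. similarity \<alpha> \<beta> (c (u + (s - v) / m)))"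
proof -
  obtain r where r: "r \<in> einterval a b"
    using c einterval_nonempty unfolding hamilton_solution_def by blast
  have "v + m * (r - u) \<in> einterval (ereal v + ereal m * (a - ereal u)) (ereal v + ereal m * (b - ereal u))"
    using r m by (simp add: mem_einterval_affine)
  then have "ereal v + ereal m * (a - ereal u) < ereal v + ereal m * (b - ereal u)"
    unfolding einterval_iff by (rule conjE) (rule less_trans)
  moreover have "fst (similarity \<alpha> \<beta> (c (u + (s - v) / m))) \<noteq> 0 \<and>
      ((\<lambda>s. similarity \<alpha> \<beta> (c (u + (s - v) / m))) has_vector_derivative
         KH_field (similarity \<alpha> \<beta> (c (u + (s - v) / m)))) (at s)"
    if s: "u + (s - v) / m \<in> einterval a b" for s
  proof
    define t where "t = u + (s - v) / m"
    have t: "fst (c t) \<noteq> 0" "(c has_vector_derivative KH_field (c t)) (at t)"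
      using s c unfolding t_def hamilton_solution_iff by blast+
    have "koranyi4 (similarity \<alpha> \<beta> (c t)) = m\<^sup>2 * koranyi4 (c t)"
      by (simp add: koranyi4_similarity m_def)
    moreover have "koranyi4 (c t) > 0" using t(1) by (simp add: koranyi4_pos_iff)
    ultimately have "koranyi4 (similarity \<alpha> \<beta> (c t)) > 0" using m by simp
    then show "fst (similarity \<alpha> \<beta> (c (u + (s - v) / m))) \<noteq> 0"
      by (simp add: t_def koranyi4_pos_iff)
    have "((\<lambda>s. u + (s - v) / m) has_vector_derivative inverse m) (at s)"
      using m by (auto intro!: derivative_eq_intros simp: has_real_derivative_iff_has_vector_derivative[symmetric] field_simps)
    from vector_diff_chain_at[OF this t(2)[unfolded t_def]]
    have "((\<lambda>s. c (u + (s - v) / m)) has_vector_derivative inverse m *\<^sub>R KH_field (c t)) (at s)"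
      by (simp add: comp_def t_def)
    from bounded_linear.has_vector_derivative[OF bounded_linear_similarity this, of \<alpha> \<beta>]
    show "((\<lambda>s. similarity \<alpha> \<beta> (c (u + (s - v) / m))) has_vector_derivative
         KH_field (similarity \<alpha> \<beta> (c (u + (s - v) / m)))) (at s)"
      using m KH_field_similarity[of \<alpha> \<beta> "c t"]
      by (simp add: t_def m_def linear_scale bounded_linear.linear bounded_linear_similarity)
  qed
  ultimately show ?thesis using m by (simp add: hamilton_solution_iff mem_einterval_affine)
qed

text \<open>The similar copy of \<open>c\<close> with time rescaled about \<open>u\<close> and shifted to \<open>v\<close> is a solution that meets \<open>c\<close>
  at time \<open>v\<close>. A maximal solution absorbs it.\<close>
lemma maximal_solution_self_similar:
  fixes \<alpha> \<beta> u v t :: real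
  defines "m \<equiv> \<alpha>\<^sup>2 + \<beta>\<^sup>2"
  assumes max: "maximal_hamilton_solution a b c" and m: "m > 0"
    and uv: "u \<in> einterval a b" "v \<in> einterval a b" "c v = similarity \<alpha> \<beta> (c u)"
    and t: "t \<in> einterval a b"
  shows "v + m * (t - u) \<in> einterval a b \<and> c (v + m * (t - u)) = similarity \<alpha> \<beta> (c t)"
proof -
  have c: "hamilton_solution a b c" using max by (simp add: maximal_hamilton_solution_def)
  note d = hamilton_solution_similarity[of a b c \<alpha> \<beta> v u, folded m_def, OF c m]
  have "v + m * (t - u) \<in> einterval a b \<and>
      c (v + m * (t - u)) = similarity \<alpha> \<beta> (c (u + ((v + m * (t - u)) - v) / m))"
    by (rule maximal_hamilton_solution_absorbs[OF max d, of v])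
       (use uv t m in \<open>simp_all add: mem_einterval_affine\<close>)
  then show ?thesis using m by simp
qed

lemma maximal_solution_self_similar_koranyi4:
  fixes u v :: real
  assumes max: "maximal_hamilton_solution a b c"
    and uv: "u \<in> einterval a b" "v \<in> einterval a b"
    and sim: "\<exists>\<alpha> \<beta>. \<alpha>\<^sup>2 + \<beta>\<^sup>2 > 0 \<and> c v = similarity \<alpha> \<beta> (c u)"
  obtains m where "m > 0"
    "\<And>t. t \<in> einterval a b \<Longrightarrow> koranyi4 (c (v + m * (t - u))) = m\<^sup>2 * koranyi4 (c t)"
proof -
  obtain \<alpha> \<beta> where m: "\<alpha>\<^sup>2 + \<beta>\<^sup>2 > 0" and cv: "c v = similarity \<alpha> \<beta> (c u)"
    using sim by blast
  show thesis
    using maximal_solution_self_similar[OF max m uv cv]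
    by (intro that[OF m]) (simp add: koranyi4_similarity)
qed

section \<open>Conserved momenta and crossings of the plane z = 0\<close>

text \<open>The momentum generating the dilations, in which \<open>z\<close> has weight \<open>2\<close>.\<close>
definition dilation_momentum :: "phase \<Rightarrow> real" where
  "dilation_momentum w = fst w $ 1 * snd w $ 1 + fst w $ 2 * snd w $ 2 + 2 * (fst w $ 3 * snd w $ 3)"

definition angular_momentum :: "phase \<Rightarrow> real" where
  "angular_momentum w = fst w $ 1 * snd w $ 2 - fst w $ 2 * snd w $ 1"

lemma has_real_derivative_components:
  fixes c :: "real \<Rightarrow> phase"
  assumes "(c has_vector_derivative v) (at t)"
  shows "((\<lambda>t. fst (c t) $ i) has_real_derivative fst v $ i) (at t)"
    and "((\<lambda>t. snd (c t) $ i) has_real_derivative snd v $ i) (at t)"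
proof -
  have "bounded_linear (\<lambda>w::phase. fst w $ i)" "bounded_linear (\<lambda>w::phase. snd w $ i)"
    by (intro bounded_linear_compose[OF bounded_linear_vec_nth] bounded_linear_fst bounded_linear_snd)+
  from this[THEN bounded_linear.has_vector_derivative, OF assms]
  show "((\<lambda>t. fst (c t) $ i) has_real_derivative fst v $ i) (at t)"
    and "((\<lambda>t. snd (c t) $ i) has_real_derivative snd v $ i) (at t)"
    by (simp_all add: has_real_derivative_iff_has_vector_derivative)
qed

lemma angular_momentum_conserved:
  assumes "(c has_vector_derivative KH_field (c t)) (at t)"
  shows "((\<lambda>t. angular_momentum (c t)) has_real_derivative 0) (at t)"
  unfolding angular_momentum_def
  by (rule derivative_eq_intros has_real_derivative_components[OF assms] refl)+
     (simp add: KH_field_def Let_def algebra_simps diff_divide_distrib add_divide_distrib)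

text \<open>Under dilations the Hamiltonian is homogeneous of degree \<open>-2\<close>, so its Poisson bracket with the
  generator of the dilations is a multiple of the Hamiltonian itself.\<close>
lemma dilation_momentum_derivative:
  assumes "(c has_vector_derivative KH_field (c t)) (at t)" and "fst (c t) \<noteq> 0"
  shows "((\<lambda>t. dilation_momentum (c t)) has_real_derivative 2 * KH_hamiltonian (c t)) (at t)"
proof -
  define x where "x = fst (c t) $ 1"
  define y where "y = fst (c t) $ 2"
  define z where "z = fst (c t) $ 3"
  define px where "px = snd (c t) $ 1"
  define py where "py = snd (c t) $ 2"
  define pz where "pz = snd (c t) $ 3"
  define s where "s = sqrt ((x\<^sup>2 + y\<^sup>2)\<^sup>2 + 16 * z\<^sup>2)"
  define k where "k = inverse (4 * pi * s ^ 3)"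
  note dfs = x_def[symmetric] y_def[symmetric] z_def[symmetric] px_def[symmetric] py_def[symmetric]
    pz_def[symmetric] s_def[symmetric] k_def[symmetric]
  have N: "(x\<^sup>2 + y\<^sup>2)\<^sup>2 + 16 * z\<^sup>2 > 0"
    using koranyi4_pos_iff[of "c t"] assms(2) by (simp add: koranyi4_def dfs)
  then have s: "s > 0" "s\<^sup>2 = (x\<^sup>2 + y\<^sup>2)\<^sup>2 + 16 * z\<^sup>2" by (simp_all add: s_def)
  \<comment> \<open>Euler's relation for the potential: it is recovered from its gradient.\<close>
  have "2 * (1 / (8 * pi * s)) = s\<^sup>2 * k"
    using s(1) by (simp add: k_def field_simps power2_eq_square power3_eq_cube)
  then have U: "2 * (1 / (8 * pi * s)) = ((x\<^sup>2 + y\<^sup>2)\<^sup>2 + 16 * z\<^sup>2) * k" using s(2) by simp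
  show ?thesis
    unfolding dilation_momentum_def
    by (rule DERIV_cong,
        (rule derivative_eq_intros has_real_derivative_components[OF assms(1)] refl)+,
        unfold KH_hamiltonian_def KH_field_def Let_def koranyi4_def dfs right_diff_distrib[of 2] U)
       (simp add: dfs power2_eq_square algebra_simps add_divide_distrib diff_divide_distrib)
qed

text \<open>With \<open>r\<close> the distance to the \<open>z\<close>-axis, in the plane \<open>z = 0\<close> the dilation momentum is
  \<open>r\<close> times the radial velocity and the quantity in parentheses is \<open>r\<close> times the tangential one. At zero energy the kinetic energy equals
  \<open>1 / (8 \<pi> r\<^sup>2)\<close>, and multiplication by \<open>2 r\<^sup>2\<close> makes \<open>r\<close> disappear.\<close>
lemma zero_energy_plane:
  assumes "KH_hamiltonian w = 0" "fst w $ 3 = 0" "\<not> (fst w $ 1 = 0 \<and> fst w $ 2 = 0)"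
  shows "(angular_momentum w + ((fst w $ 1)\<^sup>2 + (fst w $ 2)\<^sup>2) * snd w $ 3 / 2)\<^sup>2
           = 1 / (4 * pi) - (dilation_momentum w)\<^sup>2"
proof -
  define x where "x = fst w $ 1"
  define y where "y = fst w $ 2"
  define px where "px = snd w $ 1"
  define py where "py = snd w $ 2"
  define pz where "pz = snd w $ 3"
  note dfs = x_def[symmetric] y_def[symmetric] px_def[symmetric] py_def[symmetric] pz_def[symmetric]
  define r where "r = x\<^sup>2 + y\<^sup>2"
  define P where "P = px - 1/2 * y * pz"
  define Q where "Q = py + 1/2 * x * pz"
  have r: "r > 0" using assms(3) by (auto simp: r_def dfs sum_power2_gt_zero_iff)
  have "1/2 * (P\<^sup>2 + Q\<^sup>2) = 1 / (8 * pi * r)"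
    using assms(1,2) r unfolding KH_hamiltonian_def Let_def dfs
    by (simp add: P_def Q_def r_def[symmetric])
  then have "r * (P\<^sup>2 + Q\<^sup>2) = 1 / (4 * pi)" using r by (simp add: field_simps)
  moreover have "r * (P\<^sup>2 + Q\<^sup>2) = (x * Q - y * P)\<^sup>2 + (x * P + y * Q)\<^sup>2"
    by (simp add: r_def power2_eq_square algebra_simps)
  moreover have "x * P + y * Q = dilation_momentum w"
    using assms(2) by (simp add: dilation_momentum_def dfs P_def Q_def algebra_simps)
  moreover have "x * Q - y * P = angular_momentum w + r * pz / 2"
    by (simp add: angular_momentum_def dfs P_def Q_def r_def power2_eq_square algebra_simps)
  ultimately show ?thesis by (simp add: dfs r_def)
qed

text \<open>Over a point of the punctured plane, the dilation momentum \<open>J\<close> and the angular momentum \<open>L\<close>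
  determine the horizontal part of the covector: with \<open>p = p\<^sub>x + i p\<^sub>y\<close> and \<open>q = x + i y\<close>, they
  say that \<open>p = q (J + i L) / \<bar>q\<bar>\<^sup>2\<close>. The last hypothesis fixes the vertical part, so
  the similarity that carries one position to the other also matches the momenta.\<close>
lemma similar_plane_states:
  fixes u w :: phase
  defines "r \<equiv> (fst u $ 1)\<^sup>2 + (fst u $ 2)\<^sup>2" and "r' \<equiv> (fst w $ 1)\<^sup>2 + (fst w $ 2)\<^sup>2"
  assumes plane: "fst u $ 3 = 0" "fst w $ 3 = 0" and r: "r > 0" "r' > 0"
    and J: "dilation_momentum u = dilation_momentum w"
    and L: "angular_momentum u = angular_momentum w"
    and p: "r * snd u $ 3 = r' * snd w $ 3"
  shows "\<exists>a b. a\<^sup>2 + b\<^sup>2 > 0 \<and> w = similarity a b u"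
proof -
  define x where "x = fst u $ 1"
  define y where "y = fst u $ 2"
  define px where "px = snd u $ 1"
  define py where "py = snd u $ 2"
  define x' where "x' = fst w $ 1"
  define y' where "y' = fst w $ 2"
  define px' where "px' = snd w $ 1"
  define py' where "py' = snd w $ 2"
  note dfs = x_def[symmetric] y_def[symmetric] px_def[symmetric] py_def[symmetric]
     x'_def[symmetric] y'_def[symmetric] px'_def[symmetric] py'_def[symmetric]
  have rr: "r = x\<^sup>2 + y\<^sup>2" "r' = x'\<^sup>2 + y'\<^sup>2" by (simp_all add: r_def r'_def dfs)
  have J: "x * px + y * py = x' * px' + y' * py'"
    using J plane by (simp add: dilation_momentum_def dfs)
  have L: "x * py - y * px = x' * py' - y' * px'"
    using L by (simp add: angular_momentum_def dfs)
  \<comment> \<open>\<open>a + i b\<close> is the complex quotient \<open>(x' + i y') / (x + i y)\<close>.\<close>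
  define a where "a = (x * x' + y * y') / r"
  define b where "b = (x * y' - y * x') / r"
  have ra: "r * a = x * x' + y * y'" "r * b = x * y' - y * x'" using r by (simp_all add: a_def b_def)
  have "r\<^sup>2 * (a\<^sup>2 + b\<^sup>2) = (r * a)\<^sup>2 + (r * b)\<^sup>2" by (simp add: algebra_simps power_mult_distrib)
  also have "\<dots> = r * r'" unfolding ra unfolding rr by (simp add: power2_eq_square algebra_simps)
  finally have m: "r * (a\<^sup>2 + b\<^sup>2) = r'" using r by (simp add: power2_eq_square)
  then have m0: "a\<^sup>2 + b\<^sup>2 > 0" using r by (metis zero_less_mult_pos)
  have "(r * a) * x - (r * b) * y = r * x'" "(r * b) * x + (r * a) * y = r * y'"
    unfolding ra unfolding rr by (simp_all add: power2_eq_square algebra_simps)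
  then have "r * (a * x - b * y) = r * x'" "r * (b * x + a * y) = r * y'"
    by (simp_all add: algebra_simps)
  then have q: "a * x - b * y = x'" "b * x + a * y = y'" using r by simp_all
  have "r * (a * px - b * py) = x' * (x * px + y * py) - y' * (x * py - y * px)"
    unfolding right_diff_distrib mult.assoc[symmetric] ra by (simp add: algebra_simps)
  also have "\<dots> = r' * px'" unfolding J L unfolding rr by (simp add: power2_eq_square algebra_simps)
  finally have p1: "a * px - b * py = (a\<^sup>2 + b\<^sup>2) * px'" using r m by (metis mult.assoc mult_left_cancel less_irrefl)
  have "r * (b * px + a * py) = y' * (x * px + y * py) + x' * (x * py - y * px)"
    unfolding distrib_left mult.assoc[symmetric] ra by (simp add: algebra_simps)
  also have "\<dots> = r' * py'" unfolding J L unfolding rr by (simp add: power2_eq_square algebra_simps)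
  finally have p2: "b * px + a * py = (a\<^sup>2 + b\<^sup>2) * py'" using r m by (metis mult.assoc mult_left_cancel less_irrefl)
  have p3: "snd u $ 3 = (a\<^sup>2 + b\<^sup>2) * snd w $ 3" using p r m by (metis mult.assoc mult_left_cancel less_irrefl)
  have "a\<^sup>2 + b\<^sup>2 \<noteq> 0" using m0 by linarith
  then have "w = similarity a b u"
    using plane q p1 p2 p3
    by (simp add: similarity_def Let_def dfs prod_eq_iff vec_eq_iff forall_3
        del: sum_power2_eq_zero_iff)
  with m0 show ?thesis by blast
qed

text \<open>By \<open>zero_energy_plane\<close> the quantity \<open>A = L + (x\<^sup>2 + y\<^sup>2) p\<^sub>z / 2\<close> has the same square at all crossings, so by the pigeonhole
  principle two of three crossings have the same \<open>A\<close>; these two are similar. The similarity is given in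
  both directions, because a collision in the past is excluded by following the orbit backwards.\<close>
lemma A_orbit_similar_zeros:
  assumes "A_orbit a b c"
  obtains u v where "u \<in> einterval a b" "v \<in> einterval a b" "u < v"
    "\<exists>\<alpha> \<beta>. \<alpha>\<^sup>2 + \<beta>\<^sup>2 > 0 \<and> c v = similarity \<alpha> \<beta> (c u)"
    "\<exists>\<alpha> \<beta>. \<alpha>\<^sup>2 + \<beta>\<^sup>2 > 0 \<and> c u = similarity \<alpha> \<beta> (c v)"
proof -
  let ?I = "einterval a b"
  define r where "r t = (fst (c t) $ 1)\<^sup>2 + (fst (c t) $ 2)\<^sup>2" for t
  define A where "A t = angular_momentum (c t) + r t * snd (c t) $ 3 / 2" for t
  have sol: "fst (c t) \<noteq> 0" "(c has_vector_derivative KH_field (c t)) (at t)" if "t \<in> ?I" for t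
    using assms that by (auto simp: A_orbit_def maximal_hamilton_solution_def hamilton_solution_iff)
  have H: "KH_hamiltonian (c t) = 0" and ax: "\<not> (fst (c t) $ 1 = 0 \<and> fst (c t) $ 2 = 0)" if "t \<in> ?I" for t
    using assms that by (auto simp: A_orbit_def)
  have r: "r t > 0" if "t \<in> ?I" for t
    using ax[OF that] by (auto simp: r_def sum_power2_gt_zero_iff)
  have convex: "convex ?I" by (rule is_interval_convex[OF is_interval_einterval])
  have "((\<lambda>t. dilation_momentum (c t)) has_real_derivative 0) (at t)" if "t \<in> ?I" for t
    using dilation_momentum_derivative[OF sol(2)[OF that] sol(1)[OF that]] H[OF that] by simp
  then have "\<exists>J. \<forall>t\<in>?I. dilation_momentum (c t) = J"
    by (intro has_field_derivative_zero_constant[OF convex]) (rule has_field_derivative_at_within)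
  then obtain J where J: "\<And>t. t \<in> ?I \<Longrightarrow> dilation_momentum (c t) = J" by blast
  have "\<exists>L. \<forall>t\<in>?I. angular_momentum (c t) = L"
    using angular_momentum_conserved[OF sol(2)]
    by (intro has_field_derivative_zero_constant[OF convex]) (rule has_field_derivative_at_within)
  then obtain L where L: "\<And>t. t \<in> ?I \<Longrightarrow> angular_momentum (c t) = L" by blast
  obtain Z where Z: "card Z = 3" "\<forall>t\<in>Z. t isolated_in {s \<in> ?I. fst (c s) $ 3 = 0}"
    using assms by (auto simp: A_orbit_def)
  have ZI: "t \<in> ?I" "fst (c t) $ 3 = 0" if "t \<in> Z" for t
    using Z(2) that by (auto simp: isolated_in_def)
  have sq: "(A t)\<^sup>2 = 1 / (4 * pi) - J\<^sup>2" if "t \<in> Z" for t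
    using zero_energy_plane[of "c t"] ZI[OF that] H ax J by (simp add: A_def r_def)
  have "\<not> inj_on A Z"
  proof
    assume inj: "inj_on A Z"
    obtain t where t: "t \<in> Z" using Z(1) by (metis card.empty ex_in_conv zero_neq_numeral)
    have "A s \<in> {A t, - A t}" if "s \<in> Z" for s
      using sq[OF that] sq[OF t] power2_eq_iff[of "A s" "A t"] by simp
    then have "A ` Z \<subseteq> {A t, - A t}" by blast
    then have "card (A ` Z) \<le> card {A t, - A t}" by (intro card_mono) auto
    also have "\<dots> \<le> 2" by (simp add: card_insert_if)
    finally show False using card_image[OF inj] Z(1) by simp
  qed
  then obtain u v where uv: "u \<in> Z" "v \<in> Z" "A u = A v" "u < v"
    unfolding inj_on_def by (metis linorder_neqE)
  have similar: "\<exists>\<alpha> \<beta>. \<alpha>\<^sup>2 + \<beta>\<^sup>2 > 0 \<and> c t = similarity \<alpha> \<beta> (c s)"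
    if st: "s \<in> Z" "t \<in> Z" "A s = A t" for s t
    by (rule similar_plane_states)
       (use st(3) ZI[OF st(1)] ZI[OF st(2)] J L r in \<open>simp_all add: A_def r_def\<close>)
  show thesis
    using uv similar by (intro that[of u v]) (simp_all add: ZI)
qed

section \<open>Collisions\<close>

text \<open>The map \<open>t \<mapsto> v + m (t - u)\<close> moves \<open>u\<close> to the right. A contraction would have a fixed point, at which
  the scaling law fails; otherwise its iterates run to infinity with steps of length at least \<open>v - u\<close>,
  and \<open>N\<close> does not decrease along them.\<close>
lemma self_similar_not_tendsto_0_at_top:
  fixes N :: "real \<Rightarrow> real"
  assumes m: "m > 0" and uv: "u < v"
    and pos: "\<And>t. t \<ge> u \<Longrightarrow> N t > 0"
    and sim: "\<And>t. t \<ge> u \<Longrightarrow> N (v + m * (t - u)) = m\<^sup>2 * N t"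
  shows "\<not> (N \<longlongrightarrow> 0) at_top"
proof
  assume lim: "(N \<longlongrightarrow> 0) at_top"
  show False
  proof (cases "m < 1")
    case True
    \<comment> \<open>The fixed point, the sum of the geometric series of time steps.\<close>
    define s where "s = u + (v - u) / (1 - m)"
    have "s \<ge> u" using True uv by (simp add: s_def)
    moreover have "v + m * (s - u) = s"
      using True by (simp add: s_def field_simps)
    ultimately have "m\<^sup>2 * N s = N s" using sim by metis
    moreover have "N s > 0" using pos \<open>s \<ge> u\<close> by simp
    moreover have "m\<^sup>2 < 1" using True m by (simp add: power_less_one_iff)
    ultimately show False by simp
  next
    case False
    define T where "T n = ((\<lambda>t. v + m * (t - u)) ^^ n) u" for n
    have T: "T n \<ge> u + n * (v - u) \<and> N (T n) \<ge> N u" for n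
    proof (induction n)
      case 0
      show ?case by (simp add: T_def)
    next
      case (Suc n)
      have TS: "T (Suc n) = v + m * (T n - u)" by (simp add: T_def)
      have ge: "T n - u \<ge> n * (v - u)" "n * (v - u) \<ge> 0" using Suc uv by simp_all
      have "N (T (Suc n)) = m\<^sup>2 * N (T n)" unfolding TS using ge by (intro sim) linarith
      moreover have "m\<^sup>2 \<ge> 1" using False by (simp add: one_le_power)
      moreover have "N (T n) > 0" using ge by (intro pos) linarith
      ultimately have "N (T (Suc n)) \<ge> N (T n)" by (simp add: mult_le_cancel_right1)
      moreover have "m * (T n - u) \<ge> 1 * (T n - u)"
        using False ge by (intro mult_right_mono) linarith+
      ultimately show ?case using Suc ge unfolding TS by (auto simp: algebra_simps)
    qed
    have "filterlim (\<lambda>n::nat. u + n * (v - u)) at_top sequentially"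
      using uv by real_asymp
    then have "filterlim T at_top sequentially"
      by (rule filterlim_at_top_mono) (use T in auto)
    then have "(\<lambda>n. N (T n)) \<longlonglongrightarrow> 0" using lim filterlim_compose by blast
    then have "N u \<le> 0" using T by (intro LIMSEQ_le_const) auto
    then show False using pos[of u] by simp
  qed
qed

theorem corollary4p3:
  fixes c :: "real \<Rightarrow> phase" and t_minus t_plus :: ereal
  assumes "A_orbit t_minus t_plus c"
  shows "(((\<lambda>t. fst (c (real_of_ereal t))) \<longlongrightarrow> 0) (at_left t_plus) \<longrightarrow> t_plus < \<infinity>) \<and>
         (((\<lambda>t. fst (c (real_of_ereal t))) \<longlongrightarrow> 0) (at_right t_minus) \<longrightarrow> t_minus > - \<infinity>)"
proof -
  let ?I = "einterval t_minus t_plus"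
  have max: "maximal_hamilton_solution t_minus t_plus c" using assms by (simp add: A_orbit_def)
  have pos: "koranyi4 (c t) > 0" if "t \<in> ?I" for t
    using max that by (simp add: maximal_hamilton_solution_def hamilton_solution_def koranyi4_pos_iff)
  obtain u v where I: "u \<in> ?I" "v \<in> ?I" and uv: "u < v"
    and sim: "\<exists>\<alpha> \<beta>. \<alpha>\<^sup>2 + \<beta>\<^sup>2 > 0 \<and> c v = similarity \<alpha> \<beta> (c u)"
      "\<exists>\<alpha> \<beta>. \<alpha>\<^sup>2 + \<beta>\<^sup>2 > 0 \<and> c u = similarity \<alpha> \<beta> (c v)"
    using A_orbit_similar_zeros[OF assms] .
  have "t_plus < \<infinity>" if lim: "((\<lambda>t. fst (c (real_of_ereal t))) \<longlongrightarrow> 0) (at_left t_plus)"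
  proof (rule ccontr)
    assume "\<not> t_plus < \<infinity>"
    then have inf: "t_plus = \<infinity>" by simp
    obtain m where m: "m > 0"
      "\<And>t. t \<in> ?I \<Longrightarrow> koranyi4 (c (v + m * (t - u))) = m\<^sup>2 * koranyi4 (c t)"
      using maximal_solution_self_similar_koranyi4[OF max I sim(1)] by blast
    have ge: "t \<in> ?I" if "t \<ge> u" for t
      using I(1) that by (auto simp: einterval_iff inf intro: less_le_trans)
    have "((\<lambda>t. fst (c t)) \<longlongrightarrow> 0) at_top"
      using lim by (simp add: inf at_left_PInf filterlim_filtermap)
    then have "((\<lambda>t. koranyi4 (c t)) \<longlongrightarrow> 0) at_top" by (rule koranyi4_tendsto_0)
    then show False
      using self_similar_not_tendsto_0_at_top[OF m(1) uv, of "\<lambda>t. koranyi4 (c t)"] pos m(2) ge by blast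
  qed
  moreover have "t_minus > - \<infinity>"
    if lim: "((\<lambda>t. fst (c (real_of_ereal t))) \<longlongrightarrow> 0) (at_right t_minus)"
  proof (rule ccontr)
    assume "\<not> t_minus > - \<infinity>"
    then have inf: "t_minus = - \<infinity>" by simp
    obtain m where m: "m > 0"
      "\<And>t. t \<in> ?I \<Longrightarrow> koranyi4 (c (u + m * (t - v))) = m\<^sup>2 * koranyi4 (c t)"
      using maximal_solution_self_similar_koranyi4[OF max I(2,1) sim(2)] by blast
    \<comment> \<open>The orbit is followed in the reversed time \<open>- t\<close>, in which \<open>- v\<close> precedes \<open>- u\<close>.\<close>
    have le: "- t \<in> ?I" if "t \<ge> - v" for t
      using I(2) that by (auto simp: einterval_iff inf intro: le_less_trans[of _ "ereal v"])
    have "((\<lambda>t. fst (c t)) \<longlongrightarrow> 0) at_bot"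
      using lim by (simp add: inf at_right_MInf filterlim_filtermap)
    then have "((\<lambda>t. fst (c (- t))) \<longlongrightarrow> 0) at_top" by (simp add: filterlim_at_bot_mirror)
    then have "((\<lambda>t. koranyi4 (c (- t))) \<longlongrightarrow> 0) at_top" by (rule koranyi4_tendsto_0)
    moreover have "koranyi4 (c (- (- u + m * (t - - v)))) = m\<^sup>2 * koranyi4 (c (- t))"
      if "t \<ge> - v" for t
      using m(2)[OF le[OF that]] by (simp add: algebra_simps)
    ultimately show False
      using self_similar_not_tendsto_0_at_top[OF m(1), of "- v" "- u" "\<lambda>t. koranyi4 (c (- t))"]
        uv pos le by simp
  qed
  ultimately show ?thesis by blast
qed

end
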